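(* Let $\mathcal S=(S_i)_{i\geqslant 1}$ be a sequence of finite subsets $S_i\subset[-1,1]$ whose growth function $f:\mathbb N_{\geqslant 1}\to\mathbb N_{\geqslant 1}$, $f(i)=|S_i|$, is non-decreasing. For integers $d\geqslant 1$ and $\mu\geqslant 0$ let $\mathrm N_d(\mu)=|\Gamma_d(\mu)|$ be the number of nodes of the Smolyak grid $\Gamma_d(\mu)$, let $\mathcal N_d(\mu)=\sum_{|\mathbf i|=d+\mu}\prod_{k=1}^d f(i_k)$, and define the formal power series $$G_d(x)=\sum_{\mu=0}^\infty \mathrm N_d(\mu)x^\mu,\qquad \mathcal G_d(x)=\sum_{\mu=0}^\infty \mathcal N_d(\mu)x^\mu .$$ Let $$F(x)=\sum_{\ell=0}^\infty f(\ell+1)x^\ell .$$ Then: (i) If $\mathcal S$ is nested, i.e. $S_k\subset S_{k+1}$ for all $k\geqslant 1$, then $G_1(x)=F(x)$ and, for every $d\geqslant 1$, $G_d(x)=G_1(x)^d(1-x)^{d-1}$. (ii) For arbitrary (not necessarily nested) $\mathcal S$, $\mathcal G_1(x)=F(x)$ and, for every $d\geqslant 1$, $\mathcal G_d(x)=\mathcal G_1(x)^d$.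
   Context: For a multi-index $\mathbf i=(i_1,\dots,i_d)\in\mathbb N_{\geqslant 1}^d$ (all entries positive integers), $|\mathbf i|=i_1+\dots+i_d$. Sums and unions over $\mathbf i$ run over $\mathbf i\in\mathbb N_{\geqslant 1}^d$. The Smolyak grid in $d$ dimensions of level $\mu\in\mathbb N=\{0,1,2,\dots\}$ attached to $\mathcal S$ is $$\Gamma_d(\mu)=\bigcup_{\max\{d,\mu+1\}\leqslant|\mathbf i|\leqslant d+\mu}S_{i_1}\times\cdots\times S_{i_d}\subset[-1,1]^d .$$ If $\mathcal S$ is nested, this equals $\bigcup_{|\mathbf i|=d+\mu}S_{i_1}\times\cdots\times S_{i_d}$. *)

theory Defs
  imports Complex_Main "HOL-Library.FuncSet" "HOL-Computational_Algebra.Formal_Power_Series"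
begin

text \<open>
  A sequence of node sets is a function \<open>S :: nat \<Rightarrow> real set\<close> of which only the values
  \<open>S i\<close> with \<open>i \<ge> 1\<close> are used.  Since the dimension \<open>d\<close> is quantified inside the statement,
  \<open>d\<close>-tuples (multi-indices as well as grid points) are extensional functions on \<open>{1..d}\<close>,
  so that distinct functions represent distinct tuples and cardinalities are the intended ones.
\<close>

definition multi_indices :: "nat \<Rightarrow> (nat \<Rightarrow> nat) set" where
  "multi_indices d = (\<Pi>\<^sub>E k\<in>{1..d}. {1..})"

definition mi_abs :: "nat \<Rightarrow> (nat \<Rightarrow> nat) \<Rightarrow> nat" where
  "mi_abs d i = (\<Sum>k\<in>{1..d}. i k)"

definition nested :: "(nat \<Rightarrow> real set) \<Rightarrow> bool" where
  "nested S \<longleftrightarrow> (\<forall>k\<ge>1. S k \<subseteq> S (k + 1))"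

definition growth :: "(nat \<Rightarrow> real set) \<Rightarrow> nat \<Rightarrow> nat" where
  "growth S i = card (S i)"

definition smolyak_grid :: "(nat \<Rightarrow> real set) \<Rightarrow> nat \<Rightarrow> nat \<Rightarrow> (nat \<Rightarrow> real) set" where
  "smolyak_grid S d \<mu> =
     (\<Union>i\<in>{i \<in> multi_indices d. max d (\<mu> + 1) \<le> mi_abs d i \<and> mi_abs d i \<le> d + \<mu>}.
        (\<Pi>\<^sub>E k\<in>{1..d}. S (i k)))"

definition node_count :: "(nat \<Rightarrow> real set) \<Rightarrow> nat \<Rightarrow> nat \<Rightarrow> nat" where
  "node_count S d \<mu> = card (smolyak_grid S d \<mu>)"

definition product_count :: "(nat \<Rightarrow> real set) \<Rightarrow> nat \<Rightarrow> nat \<Rightarrow> nat" where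
  "product_count S d \<mu> =
     (\<Sum>i\<in>{i \<in> multi_indices d. mi_abs d i = d + \<mu>}. \<Prod>k\<in>{1..d}. growth S (i k))"

text \<open>Integer coefficients, because of the factor \<open>1 - x\<close>.\<close>

definition node_gf :: "(nat \<Rightarrow> real set) \<Rightarrow> nat \<Rightarrow> int fps" where
  "node_gf S d = Abs_fps (\<lambda>\<mu>. int (node_count S d \<mu>))"

definition product_gf :: "(nat \<Rightarrow> real set) \<Rightarrow> nat \<Rightarrow> int fps" where
  "product_gf S d = Abs_fps (\<lambda>\<mu>. int (product_count S d \<mu>))"

definition growth_gf :: "(nat \<Rightarrow> real set) \<Rightarrow> int fps" where
  "growth_gf S = Abs_fps (\<lambda>l. int (growth S (l + 1)))"

text \<open>
  \<open>sum\<close> and \<open>card\<close> are \<open>0\<close> on infinite sets; the next two facts show that this convention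
  plays no role in the two counts.
\<close>

lemma finite_multi_indices_le: "finite {i \<in> multi_indices d. mi_abs d i \<le> n}"
proof (rule finite_subset)
  show "{i \<in> multi_indices d. mi_abs d i \<le> n} \<subseteq> (\<Pi>\<^sub>E k\<in>{1..d}. {..n})"
  proof
    fix i assume i: "i \<in> {i \<in> multi_indices d. mi_abs d i \<le> n}"
    have "i k \<le> n" if "k \<in> {1..d}" for k
    proof -
      have "i k \<le> (\<Sum>k\<in>{1..d}. i k)"
        using that by (intro member_le_sum) auto
      then show ?thesis using i by (simp add: mi_abs_def)
    qed
    then show "i \<in> (\<Pi>\<^sub>E k\<in>{1..d}. {..n})"
      using i by (auto simp: multi_indices_def PiE_iff)
  qed
  show "finite (\<Pi>\<^sub>E k\<in>{1..d}. {..n})"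
    by (intro finite_PiE) auto
qed

lemma finite_smolyak_grid:
  assumes "\<And>i. i \<ge> 1 \<Longrightarrow> finite (S i)"
  shows "finite (smolyak_grid S d \<mu>)"
  unfolding smolyak_grid_def
proof (rule finite_UN_I)
  show "finite {i \<in> multi_indices d. max d (\<mu> + 1) \<le> mi_abs d i \<and> mi_abs d i \<le> d + \<mu>}"
    by (rule finite_subset[OF _ finite_multi_indices_le[of d "d + \<mu>"]]) auto
next
  fix i assume "i \<in> {i \<in> multi_indices d. max d (\<mu> + 1) \<le> mi_abs d i \<and> mi_abs d i \<le> d + \<mu>}"
  then show "finite (\<Pi>\<^sub>E k\<in>{1..d}. S (i k))"
    by (intro finite_PiE assms) (auto simp: multi_indices_def PiE_iff)
qed

end

theory Submission
  imports Defs
begin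

text \<open>
  Multiplying out \<open>F ^ d\<close> gives (ii), for any weight function in place of the growth function.
  For (i), split \<open>S i\<close> into its new points \<open>D i = S i - S (i - 1)\<close>.  By nestedness the grid of
  level \<open>\<mu>\<close> is the disjoint union of the boxes \<open>D i\<^sub>1 \<times> \<dots> \<times> D i\<^sub>d\<close> with \<open>|i| \<le> d + \<mu>\<close>, so
  \<open>(1 - x) G\<^sub>d\<close> is the series of (ii) for the weights \<open>|D i|\<close>, namely \<open>((1 - x) F) ^ d\<close>.
  Cancel one factor \<open>1 - x\<close>.
\<close>

unbundle fps_syntax

section \<open>Product weights on multi-indices and powers of series\<close>

lemma mi_abs_fun_upd_Suc: "mi_abs (Suc d) (i(Suc d := n)) = n + mi_abs d i"
proof -
  have "(\<Sum>k\<in>{1..d}. (i(Suc d := n)) k) = (\<Sum>k\<in>{1..d}. i k)"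
    by (intro sum.cong) auto
  then show ?thesis
    by (simp add: mi_abs_def)
qed

lemma mi_abs_restrict: "mi_abs d (restrict i {1..d}) = mi_abs d i"
  by (simp add: mi_abs_def)

lemma mi_abs_mono: "(\<And>k. k \<in> {1..d} \<Longrightarrow> i k \<le> j k) \<Longrightarrow> mi_abs d i \<le> mi_abs d j"
  unfolding mi_abs_def by (rule sum_mono)

lemma multi_indices_mi_abs_ge:
  assumes "i \<in> multi_indices d"
  shows "d \<le> mi_abs d i"
proof -
  have "mi_abs d (\<lambda>_. 1) \<le> mi_abs d i"
    using assms by (intro mi_abs_mono) (auto simp: multi_indices_def PiE_iff)
  then show ?thesis
    by (simp add: mi_abs_def)
qed

text \<open>Induction on \<open>d\<close>: a last entry \<open>l + 1\<close> leaves the total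
  \<open>d + (\<mu> - l)\<close> to the first \<open>d\<close> entries, which is the Cauchy product.
  The weight \<open>h\<close> is arbitrary so that both the sizes of the node sets and the numbers
  of new points can be substituted.\<close>

lemma fps_sum_multi_indices:
  fixes h :: "nat \<Rightarrow> 'a::comm_semiring_1"
  shows "Abs_fps (\<lambda>\<mu>. \<Sum>i\<in>{i \<in> multi_indices d. mi_abs d i = d + \<mu>}. \<Prod>k\<in>{1..d}. h (i k))
           = Abs_fps (\<lambda>l. h (l + 1)) ^ d"
proof (induction d)
  case 0
  \<comment> \<open>The only multi-index of length 0 is the constant \<open>undefined\<close>
    function. It has total 0 and empty product 1, so the series is 1.\<close>
  show ?case
    by (rule fps_ext) (auto simp: multi_indices_def mi_abs_def)
next
  case (Suc d)
  let ?I = "\<lambda>d \<mu>. {i \<in> multi_indices d. mi_abs d i = d + \<mu>}"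
  show ?case
  proof (rule fps_ext)
    fix \<mu>
    have "(\<Sum>i\<in>?I (Suc d) \<mu>. \<Prod>k\<in>{1..Suc d}. h (i k))
        = (\<Sum>(l, i)\<in>Sigma {0..\<mu>} (\<lambda>l. ?I d (\<mu> - l)). h (l + 1) * (\<Prod>k\<in>{1..d}. h (i k)))"
    proof (rule sum.reindex_bij_witness[where i = "\<lambda>(l, i). i(Suc d := l + 1)"
              and j = "\<lambda>i. (i (Suc d) - 1, restrict i {1..d})"])
      fix i assume i: "i \<in> ?I (Suc d) \<mu>"
      have pos: "i k \<ge> 1" if "k \<in> {1..Suc d}" for k
        using i that by (auto simp: multi_indices_def PiE_iff)
      have ext: "i k = undefined" if "k \<notin> {1..Suc d}" for k
        using i that by (auto simp: multi_indices_def PiE_iff extensional_def)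
      have r: "restrict i {1..d} \<in> multi_indices d"
        using pos by (auto simp: multi_indices_def)
      have last: "i (Suc d) \<ge> 1"
        using pos by simp
      have "mi_abs (Suc d) i = i (Suc d) + mi_abs d i"
        using mi_abs_fun_upd_Suc[of d i "i (Suc d)"] by simp
      \<comment> \<open>The first \<open>d\<close> entries total at least \<open>d\<close>, so the
        last is at most \<open>\<mu> + 1\<close>; being at least 1, it is not truncated by
        \<open>- 1\<close>.\<close>
      then show "(i (Suc d) - 1, restrict i {1..d}) \<in> Sigma {0..\<mu>} (\<lambda>l. ?I d (\<mu> - l))"
        using i r last multi_indices_mi_abs_ge[OF r]
        unfolding mem_Sigma_iff mem_Collect_eq mi_abs_restrict atLeastAtMost_iff by linarith
      show "(case (i (Suc d) - 1, restrict i {1..d}) of (l, i) \<Rightarrow> i(Suc d := l + 1)) = i"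
        using last ext by (auto simp: fun_eq_iff restrict_def)
      show "(case (i (Suc d) - 1, restrict i {1..d}) of
              (l, i) \<Rightarrow> h (l + 1) * (\<Prod>k\<in>{1..d}. h (i k))) = (\<Prod>k\<in>{1..Suc d}. h (i k))"
        using last by (simp add: mult.commute)
    next
      fix p assume "p \<in> Sigma {0..\<mu>} (\<lambda>l. ?I d (\<mu> - l))"
      then obtain l i where p: "p = (l, i)" "l \<le> \<mu>" "i \<in> multi_indices d" "mi_abs d i = d + (\<mu> - l)"
        by auto
      have "i(Suc d := l + 1) \<in> multi_indices (Suc d)"
        using p(3) by (auto simp: multi_indices_def PiE_iff extensional_def)
      then show "(case p of (l, i) \<Rightarrow> i(Suc d := l + 1)) \<in> ?I (Suc d) \<mu>"
        using p by (simp add: mi_abs_fun_upd_Suc)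
      have "restrict (i(Suc d := l + 1)) {1..d} = i"
        using p(3) by (auto simp: multi_indices_def PiE_iff extensional_def fun_eq_iff)
      then show "((case p of (l, i) \<Rightarrow> i(Suc d := l + 1)) (Suc d) - 1,
                  restrict (case p of (l, i) \<Rightarrow> i(Suc d := l + 1)) {1..d}) = p"
        using p(1) by simp
    qed
    also have "\<dots> = (\<Sum>l=0..\<mu>. \<Sum>i\<in>?I d (\<mu> - l). h (l + 1) * (\<Prod>k\<in>{1..d}. h (i k)))"
      by (rule sum.Sigma[symmetric])
        (auto intro: finite_subset[OF _ finite_multi_indices_le])
    also have "\<dots> = (\<Sum>l=0..\<mu>. h (l + 1) * (\<Sum>i\<in>?I d (\<mu> - l). \<Prod>k\<in>{1..d}. h (i k)))"
      by (simp add: sum_distrib_left)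
    also have "\<dots> = (Abs_fps (\<lambda>l. h (l + 1)) ^ Suc d) $ \<mu>"
      unfolding power_Suc fps_mult_nth Suc.IH[symmetric] by simp
    finally show "Abs_fps (\<lambda>\<mu>. \<Sum>i\<in>?I (Suc d) \<mu>. \<Prod>k\<in>{1..Suc d}. h (i k)) $ \<mu>
        = (Abs_fps (\<lambda>l. h (l + 1)) ^ Suc d) $ \<mu>"
      by simp
  qed
qed

lemma product_gf_eq_power: "product_gf S d = growth_gf S ^ d"
  using fps_sum_multi_indices[where d = d and h = "\<lambda>i. int (growth S i)"]
  by (simp add: product_gf_def product_count_def growth_gf_def)

section \<open>New points and the decomposition of nested grids\<close>

definition new_nodes :: "(nat \<Rightarrow> real set) \<Rightarrow> nat \<Rightarrow> real set" where
  "new_nodes S i = S i - (\<Union>j\<in>{1..<i}. S j)"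

text \<open>\<open>new_nodes\<close> removes every earlier set, so a point is new at its first level
  only. Positivity of the indices matters because the removed union starts at index 1.\<close>

lemma new_nodes_unique:
  assumes "x \<in> new_nodes S i" "x \<in> new_nodes S j" "i \<ge> 1" "j \<ge> 1"
  shows "i = j"
  using assms by (cases i j rule: linorder_cases) (auto simp: new_nodes_def)

lemma nested_mono:
  assumes "nested S" "1 \<le> i" "i \<le> j"
  shows "S i \<subseteq> S j"
  using assms(3)
proof (induction rule: dec_induct)
  case (step n)
  then have "S n \<subseteq> S (Suc n)"
    using assms(1,2) by (simp add: nested_def)
  then show ?case
    using step.IH by blast
qed simp

lemma one_minus_X_mult_nth:
  fixes f :: "'a::comm_ring_1 fps"
  shows "((1 - fps_X) * f) $ n = f $ n - (if n = 0 then 0 else f $ (n - 1))"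
  by (simp add: left_diff_distrib)

text \<open>By nestedness the union of the earlier sets collapses to the preceding one, so the
  numbers of new points are the first differences of the growth function; multiplication by
  \<open>1 - fps_X\<close> takes such differences.\<close>

lemma new_nodes_gf:
  assumes "nested S" "\<And>i. i \<ge> 1 \<Longrightarrow> finite (S i)"
  shows "Abs_fps (\<lambda>l. int (card (new_nodes S (l + 1)))) = (1 - fps_X) * growth_gf S"
proof (rule fps_ext)
  fix n
  show "Abs_fps (\<lambda>l. int (card (new_nodes S (l + 1)))) $ n = ((1 - fps_X) * growth_gf S) $ n"
  proof (cases n)
    case 0
    then show ?thesis
      by (simp add: one_minus_X_mult_nth growth_gf_def growth_def new_nodes_def)
  next
    case (Suc m)
    have "S j \<subseteq> S (Suc m)" if "j \<in> {1..<Suc (Suc m)}" for j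
      using that by (intro nested_mono[OF assms(1)]) auto
    then have "(\<Union>j\<in>{1..<Suc (Suc m)}. S j) = S (Suc m)"
      by (intro equalityI UN_least UN_upper) auto
    then have "new_nodes S (n + 1) = S (Suc (Suc m)) - S (Suc m)"
      using Suc by (simp add: new_nodes_def)
    moreover have sub: "S (Suc m) \<subseteq> S (Suc (Suc m))"
      by (rule nested_mono[OF assms(1)]) auto
    ultimately have "int (card (new_nodes S (n + 1))) = int (card (S (Suc (Suc m)))) - int (card (S (Suc m)))"
      using card_mono[OF assms(2) sub] card_Diff_subset[OF finite_subset[OF sub assms(2)] sub]
      by (simp add: of_nat_diff)
    then show ?thesis
      using Suc by (simp add: one_minus_X_mult_nth growth_gf_def growth_def)
  qed
qed

text \<open>A grid point lies in the box indexed by the first levels of its coordinates, and passing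
  to first levels cannot raise the total. Conversely, nestedness keeps a new point in all later
  sets.\<close>

lemma smolyak_grid_eq_new_nodes:
  assumes "nested S" "d \<ge> 1"
  shows "smolyak_grid S d \<mu> = (\<Union>i\<in>{i \<in> multi_indices d. mi_abs d i \<le> d + \<mu>}.
           \<Pi>\<^sub>E k\<in>{1..d}. new_nodes S (i k))"
proof (intro equalityI subsetI)
  fix x assume "x \<in> smolyak_grid S d \<mu>"
  then obtain i where i: "i \<in> multi_indices d" "mi_abs d i \<le> d + \<mu>"
    and x: "x \<in> (\<Pi>\<^sub>E k\<in>{1..d}. S (i k))"
    by (auto simp: smolyak_grid_def)
  \<comment> \<open>The first level at which each coordinate occurs: minimality keeps
    \<open>x k\<close> out of all earlier sets. The restriction to \<open>{1..d}\<close> makes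
    \<open>j\<close> extensional.\<close>
  define j where "j = (\<lambda>k\<in>{1..d}. LEAST l. l \<ge> 1 \<and> x k \<in> S l)"
  have j: "j k \<ge> 1 \<and> x k \<in> new_nodes S (j k) \<and> j k \<le> i k" if k: "k \<in> {1..d}" for k
  proof -
    let ?P = "\<lambda>l. l \<ge> 1 \<and> x k \<in> S l"
    have P: "?P (i k)"
      using i(1) x k by (auto simp: multi_indices_def PiE_iff)
    have jk: "j k = (LEAST l. ?P l)"
      using k by (simp add: j_def)
    have "?P (j k)" "j k \<le> i k"
      unfolding jk using P by (rule LeastI, rule Least_le)
    moreover have "\<not> ?P l" if "l < j k" for l
      using that unfolding jk by (rule not_less_Least)
    ultimately show ?thesis
      by (auto simp: new_nodes_def)
  qed
  have "j \<in> multi_indices d"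
    using j by (auto simp: multi_indices_def j_def PiE_iff)
  moreover have "mi_abs d j \<le> d + \<mu>"
    using mi_abs_mono[of d j i] j i(2) le_trans by blast
  moreover have "x \<in> (\<Pi>\<^sub>E k\<in>{1..d}. new_nodes S (j k))"
    using x j by (auto simp: PiE_iff)
  ultimately show "x \<in> (\<Union>i\<in>{i \<in> multi_indices d. mi_abs d i \<le> d + \<mu>}.
           \<Pi>\<^sub>E k\<in>{1..d}. new_nodes S (i k))"
    by blast
next
  fix x assume "x \<in> (\<Union>i\<in>{i \<in> multi_indices d. mi_abs d i \<le> d + \<mu>}.
           \<Pi>\<^sub>E k\<in>{1..d}. new_nodes S (i k))"
  then obtain j where j: "j \<in> multi_indices d" "mi_abs d j \<le> d + \<mu>"
    and x: "x \<in> (\<Pi>\<^sub>E k\<in>{1..d}. new_nodes S (j k))"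
    by auto
  \<comment> \<open>Raising one entry of \<open>j\<close> to reach \<open>|i| = d + \<mu>\<close> guarantees the lower bound \<open>max d (\<mu> + 1)\<close>.\<close>
  define i where "i = j(1 := j 1 + (d + \<mu> - mi_abs d j))"
  have "1 \<le> j k \<and> j k \<le> i k" if "k \<in> {1..d}" for k
    using j(1) that by (auto simp: i_def multi_indices_def PiE_iff)
  then have sub: "new_nodes S (j k) \<subseteq> S (i k)" if "k \<in> {1..d}" for k
    using nested_mono[OF assms(1), of "j k" "i k"] that by (auto simp: new_nodes_def)
  have "i \<in> multi_indices d"
    using j(1) assms(2) by (auto simp: i_def multi_indices_def PiE_iff extensional_def intro: trans_le_add1)
  moreover have "mi_abs d i = d + \<mu>"
  proof -
    have "mi_abs d i = i 1 + (\<Sum>k\<in>{1..d} - {1}. i k)"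
      unfolding mi_abs_def using assms(2) by (intro sum.remove) auto
    also have "(\<Sum>k\<in>{1..d} - {1}. i k) = (\<Sum>k\<in>{1..d} - {1}. j k)"
      by (intro sum.cong) (auto simp: i_def)
    also have "i 1 + \<dots> = (d + \<mu> - mi_abs d j) + (j 1 + \<dots>)"
      by (simp add: i_def)
    also have "j 1 + (\<Sum>k\<in>{1..d} - {1}. j k) = mi_abs d j"
      unfolding mi_abs_def using assms(2) by (intro sum.remove[symmetric]) auto
    \<comment> \<open>The truncated subtraction is exact because
      \<open>mi_abs d j \<le> d + \<mu>\<close>.\<close>
    finally show ?thesis
      using j(2) by simp
  qed
  moreover have "x \<in> (\<Pi>\<^sub>E k\<in>{1..d}. S (i k))"
    by (rule subsetD[OF PiE_mono[OF sub] x])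
  ultimately show "x \<in> smolyak_grid S d \<mu>"
    using assms(2) unfolding smolyak_grid_def by (intro UN_I[of i]) auto
qed

text \<open>The boxes are pairwise disjoint: each coordinate of a common point is new at one level
  only, which fixes the entry there, and extensionality then identifies the two indices.\<close>

lemma node_count_eq_sum:
  assumes "nested S" "\<And>i. i \<ge> 1 \<Longrightarrow> finite (S i)" "d \<ge> 1"
  shows "node_count S d \<mu> = (\<Sum>i\<in>{i \<in> multi_indices d. mi_abs d i \<le> d + \<mu>}.
           \<Prod>k\<in>{1..d}. card (new_nodes S (i k)))"
proof -
  have "card (\<Union>i\<in>{i \<in> multi_indices d. mi_abs d i \<le> d + \<mu>}. \<Pi>\<^sub>E k\<in>{1..d}. new_nodes S (i k))
      = (\<Sum>i\<in>{i \<in> multi_indices d. mi_abs d i \<le> d + \<mu>}. card (\<Pi>\<^sub>E k\<in>{1..d}. new_nodes S (i k)))"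
  proof (rule card_UN_disjoint[OF finite_multi_indices_le])
    show "\<forall>i\<in>{i \<in> multi_indices d. mi_abs d i \<le> d + \<mu>}. finite (\<Pi>\<^sub>E k\<in>{1..d}. new_nodes S (i k))"
      using assms(2) by (auto simp: multi_indices_def new_nodes_def PiE_iff intro!: finite_PiE)
    have "i = j" if "i \<in> multi_indices d" "j \<in> multi_indices d"
      "x \<in> (\<Pi>\<^sub>E k\<in>{1..d}. new_nodes S (i k))" "x \<in> (\<Pi>\<^sub>E k\<in>{1..d}. new_nodes S (j k))" for i j x
    proof (rule PiE_ext[OF that(1,2)[unfolded multi_indices_def]])
      fix k assume "k \<in> {1..d}"
      with that show "i k = j k"
        by (intro new_nodes_unique[of "x k" S]) (auto simp: multi_indices_def PiE_iff)
    qed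
    then show "\<forall>i\<in>{i \<in> multi_indices d. mi_abs d i \<le> d + \<mu>}.
        \<forall>j\<in>{i \<in> multi_indices d. mi_abs d i \<le> d + \<mu>}. i \<noteq> j \<longrightarrow>
          (\<Pi>\<^sub>E k\<in>{1..d}. new_nodes S (i k)) \<inter> (\<Pi>\<^sub>E k\<in>{1..d}. new_nodes S (j k)) = {}"
      by blast
  qed
  then show ?thesis
    by (simp add: node_count_def smolyak_grid_eq_new_nodes[OF assms(1,3)] card_PiE)
qed

section \<open>Generating function of the node counts\<close>

lemma one_minus_X_mult_node_gf:
  assumes "nested S" "\<And>i. i \<ge> 1 \<Longrightarrow> finite (S i)" "d \<ge> 1"
  shows "(1 - fps_X) * node_gf S d = ((1 - fps_X) * growth_gf S) ^ d"
proof -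
  let ?w = "\<lambda>i. \<Prod>k\<in>{1..d}. int (card (new_nodes S (i k)))"
  let ?E = "\<lambda>\<mu>. {i \<in> multi_indices d. mi_abs d i = d + \<mu>}"
  let ?L = "\<lambda>\<mu>. {i \<in> multi_indices d. mi_abs d i \<le> d + \<mu>}"
  have node: "node_gf S d $ \<mu> = sum ?w (?L \<mu>)" for \<mu>
    by (simp add: node_gf_def node_count_eq_sum[OF assms])
  \<comment> \<open>Consecutive cutoffs \<open>?L\<close> differ by exactly one layer
    \<open>?E\<close>, so \<open>1 - fps_X\<close> turns cumulative sums into sums over single
    layers.\<close>
  have "((1 - fps_X) * node_gf S d) $ \<mu> = sum ?w (?E \<mu>)" for \<mu>
  proof (cases \<mu>)
    case 0
    \<comment> \<open>There is no earlier coefficient to subtract, but totals are at least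
      \<open>d\<close>, so the cutoff is already a single layer.\<close>
    have "?L 0 = ?E 0"
      using multi_indices_mi_abs_ge by force
    then show ?thesis
      using 0 by (simp add: one_minus_X_mult_nth node)
  next
    case (Suc m)
    have "?L (Suc m) = ?L m \<union> ?E (Suc m)"
      by auto
    moreover have "finite (?E (Suc m))"
      by (rule finite_subset[OF _ finite_multi_indices_le[of d "d + Suc m"]]) auto
    ultimately have "sum ?w (?L (Suc m)) = sum ?w (?L m) + sum ?w (?E (Suc m))"
      by (auto intro!: sum.union_disjoint finite_multi_indices_le)
    then show ?thesis
      using Suc by (simp add: one_minus_X_mult_nth node)
  qed
  then have "(1 - fps_X) * node_gf S d = Abs_fps (\<lambda>\<mu>. sum ?w (?E \<mu>))"
    by (intro fps_ext) simp
  also have "\<dots> = ((1 - fps_X) * growth_gf S) ^ d"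
    using fps_sum_multi_indices[where d = d and h = "\<lambda>i. int (card (new_nodes S i))"]
    by (simp only: new_nodes_gf[OF assms(1,2)])
  finally show ?thesis .
qed

text \<open>Integer power series form an integral domain, so one factor \<open>1 - fps_X\<close>
  cancels; \<open>d \<ge> 1\<close> guarantees that the right-hand side contains it.\<close>

lemma node_gf_eq:
  assumes "nested S" "\<And>i. i \<ge> 1 \<Longrightarrow> finite (S i)" "d \<ge> 1"
  shows "node_gf S d = growth_gf S ^ d * (1 - fps_X) ^ (d - 1)"
proof -
  have "(1 - fps_X) * node_gf S d = (1 - fps_X) * (growth_gf S ^ d * (1 - fps_X) ^ (d - 1))"
    using one_minus_X_mult_node_gf[OF assms] assms(3)
    by (cases d) (simp_all add: power_mult_distrib mult_ac)
  \<comment> \<open>The constant coefficient 1 shows that the factor to be cancelled is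
    nonzero.\<close>
  moreover have "(1 - fps_X :: int fps) $ 0 \<noteq> 0 $ 0"
    by simp
  then have "(1 - fps_X :: int fps) \<noteq> 0"
    by metis
  ultimately show ?thesis
    by simp
qed

theorem theorem1p1:
  fixes S :: "nat \<Rightarrow> real set"
  assumes "\<And>i. i \<ge> 1 \<Longrightarrow> finite (S i)"
    and "\<And>i. i \<ge> 1 \<Longrightarrow> S i \<subseteq> {-1..1}"
    and "\<And>i. i \<ge> 1 \<Longrightarrow> growth S i \<ge> 1"
    and "mono_on {1..} (growth S)"
  shows "(nested S \<longrightarrow>
            node_gf S 1 = growth_gf S \<and>
            (\<forall>d\<ge>1. node_gf S d = node_gf S 1 ^ d * (1 - fps_X) ^ (d - 1))) \<and>
         product_gf S 1 = growth_gf S \<and>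
         (\<forall>d\<ge>1. product_gf S d = product_gf S 1 ^ d)"
proof (intro conjI impI allI)
  assume nested: "nested S"
  note node = node_gf_eq[OF nested assms(1)]
  \<comment> \<open>For \<open>d = 1\<close> the factor \<open>1 - fps_X\<close> has exponent
    0.\<close>
  show one: "node_gf S 1 = growth_gf S"
    by (simp add: node)
  show "node_gf S d = node_gf S 1 ^ d * (1 - fps_X) ^ (d - 1)" if "d \<ge> 1" for d
    using node[OF _ that] one by simp
next
  show "product_gf S 1 = growth_gf S"
    by (simp add: product_gf_eq_power)
  show "product_gf S d = product_gf S 1 ^ d" for d
    by (simp add: product_gf_eq_power)
qed

end
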